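(* Let $\Phi\subset\mathbb{R}^N\setminus\{0\}$ be a (finite) frame for $\mathbb{R}^N$. Then the following conditions are equivalent. (i) $\Phi$ is not scalable. (ii) All frame vectors of $\Phi$ are contained in the interior of a conical zero-trace quadric of $\mathcal{C}_N$. (iii) All frame vectors of $\Phi$ are contained in the exterior of a conical zero-trace quadric of $\mathcal{C}_N$.
   Context: A finite family $\Phi=\{\varphi_j\}_{j=1}^M\subset\mathbb{R}^N$ is a frame for $\mathbb{R}^N$ if there are $A,B>0$ with $A\|x\|^2\le\sum_{j=1}^M|\langle x,\varphi_j\rangle|^2\le B\|x\|^2$ for all $x\in\mathbb{R}^N$; it is a Parseval frame if this holds with $A=B=1$. A frame $\{\varphi_j\}_{j=1}^M$ is scalable if there exist scalars $c_j\ge 0$ such that $\{c_j\varphi_j\}_{j=1}^M$ is a Parseval frame. The class $\mathcal{C}_N$ of conical zero-trace quadrics is the family of sets $$\Big\{x\in\mathbb{R}^N:\sum_{k=1}^{N-1}a_k\langle x,e_k\rangle^2=\langle x,e_N\rangle^2\Big\},$$ where $\{e_k\}_{k=1}^N$ runs through all orthonormal bases of $\mathbb{R}^N$ and $(a_k)_{k=1}^{N-1}$ runs through all tuples of elements of $\mathbb{R}\setminus\{0\}$ with $\sum_{k=1}^{N-1}a_k=1$. For the quadric given by $\{e_k\}_{k=1}^N$ and $(a_k)_{k=1}^{N-1}$, its interior and its exterior are, respectively, the sets $$\Big\{x\in\mathbb{R}^N:\sum_{k=1}^{N-1}a_k\langle x,e_k\rangle^2<\langle x,e_N\rangle^2\Big\}\quad\text{and}\quad\Big\{x\in\mathbb{R}^N:\sum_{k=1}^{N-1}a_k\langle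 x,e_k\rangle^2>\langle x,e_N\rangle^2\Big\}$$ (defined by means of the given data $\{e_k\}$, $(a_k)$). *)

theory Defs
  imports "HOL-Analysis.Analysis"
begin

text \<open>A family of \<open>M\<close> vectors is \<open>\<phi> 1, \<dots>, \<phi> M\<close>; values of \<open>\<phi>\<close> outside \<open>{1..M}\<close> are irrelevant.\<close>

definition frame_bounds :: "nat \<Rightarrow> (nat \<Rightarrow> real ^ 'n) \<Rightarrow> real \<Rightarrow> real \<Rightarrow> bool" where
  "frame_bounds M \<phi> A B \<longleftrightarrow>
     (\<forall>x. A * (norm x)\<^sup>2 \<le> (\<Sum>j=1..M. \<bar>x \<bullet> \<phi> j\<bar>\<^sup>2) \<and>
          (\<Sum>j=1..M. \<bar>x \<bullet> \<phi> j\<bar>\<^sup>2) \<le> B * (norm x)\<^sup>2)"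

definition is_frame :: "nat \<Rightarrow> (nat \<Rightarrow> real ^ 'n) \<Rightarrow> bool" where
  "is_frame M \<phi> \<longleftrightarrow> (\<exists>A>0. \<exists>B>0. frame_bounds M \<phi> A B)"

definition parseval_frame :: "nat \<Rightarrow> (nat \<Rightarrow> real ^ 'n) \<Rightarrow> bool" where
  "parseval_frame M \<phi> \<longleftrightarrow> frame_bounds M \<phi> 1 1"

definition scalable :: "nat \<Rightarrow> (nat \<Rightarrow> real ^ 'n) \<Rightarrow> bool" where
  "scalable M \<phi> \<longleftrightarrow>
     (\<exists>c :: nat \<Rightarrow> real. (\<forall>j\<in>{1..M}. c j \<ge> 0) \<and> parseval_frame M (\<lambda>j. c j *\<^sub>R \<phi> j))"

definition orthonormal_basis :: "(nat \<Rightarrow> real ^ 'n) \<Rightarrow> bool" where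
  "orthonormal_basis e \<longleftrightarrow>
     (\<forall>i\<in>{1..CARD('n)}. \<forall>k\<in>{1..CARD('n)}. e i \<bullet> e k = (if i = k then 1 else 0)) \<and>
     span (e ` {1..CARD('n)}) = UNIV"

text \<open>The data \<open>e 1, \<dots>, e N\<close> and \<open>a 1, \<dots>, a (N - 1)\<close>, where \<open>N = CARD('n)\<close>. For \<open>N = 1\<close> the
  sum is empty, so there is no admissible data and the class of quadrics is empty.\<close>

definition quadric_data :: "(nat \<Rightarrow> real ^ 'n) \<Rightarrow> (nat \<Rightarrow> real) \<Rightarrow> bool" where
  "quadric_data e a \<longleftrightarrow>
     orthonormal_basis e \<and> (\<forall>k\<in>{1..CARD('n) - 1}. a k \<noteq> 0) \<and> (\<Sum>k=1..CARD('n) - 1. a k) = 1"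

definition quadric :: "(nat \<Rightarrow> real ^ 'n) \<Rightarrow> (nat \<Rightarrow> real) \<Rightarrow> (real ^ 'n) set" where
  "quadric e a = {x. (\<Sum>k=1..CARD('n) - 1. a k * (x \<bullet> e k)\<^sup>2) = (x \<bullet> e CARD('n))\<^sup>2}"

definition conical_zero_trace_quadrics :: "(real ^ 'n) set set" where
  "conical_zero_trace_quadrics = {quadric e a | e a. quadric_data e a}"

text \<open>Interior and exterior are attached to the data, not to the quadric as a point set: for
  \<open>N = 2\<close>, swapping \<open>e 1\<close> and \<open>e 2\<close> keeps the quadric but exchanges the two.\<close>

definition quadric_interior :: "(nat \<Rightarrow> real ^ 'n) \<Rightarrow> (nat \<Rightarrow> real) \<Rightarrow> (real ^ 'n) set" where
  "quadric_interior e a = {x. (\<Sum>k=1..CARD('n) - 1. a k * (x \<bullet> e k)\<^sup>2) < (x \<bullet> e CARD('n))\<^sup>2}"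

definition quadric_exterior :: "(nat \<Rightarrow> real ^ 'n) \<Rightarrow> (nat \<Rightarrow> real) \<Rightarrow> (real ^ 'n) set" where
  "quadric_exterior e a = {x. (\<Sum>k=1..CARD('n) - 1. a k * (x \<bullet> e k)\<^sup>2) > (x \<bullet> e CARD('n))\<^sup>2}"

end

theory Submission
  imports Defs
begin

text \<open>A family \<open>\<phi>\<close> is scalable iff the identity matrix lies in the cone generated by the
  matrices \<open>\<phi> j (\<phi> j)\<^sup>T\<close>. If it does not, a hyperplane separates \<open>I / N\<close> strictly from the
  convex hull of these matrices normalised to trace 1, which yields a traceless quadratic form that
  is strictly positive on every \<open>\<phi> j\<close>. Diagonalise it in an orthonormal basis and perturb the
  eigenvalues so that none of them is 0. Dividing by a positive eigenvalue, whose eigenvector is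
  taken as \<open>e N\<close>, gives a quadric with all \<open>\<phi> j\<close> in its interior; dividing by a negative one
  gives the exterior. Conversely, evaluating the Parseval identity of a scaled family at the
  \<open>e k\<close> shows that the quadratic form of the quadric, summed over the family, is its trace 0, so it
  cannot have one strict sign.\<close>

section \<open>Orthonormal diagonalisation of a symmetric bilinear form\<close>

text \<open>Spectral theorem by induction on dimension, splitting off one unit vector at a time. The
  conclusion asks for conjugate vectors rather than eigenvectors because \<open>f\<close> need not
  map \<open>S\<close> into itself; this lets the induction pass to arbitrary subspaces.\<close>

lemma orthonormal_diagonalizing_basis:
  fixes f :: "'a::euclidean_space \<Rightarrow> 'a"
  assumes lin: "linear f" and sym: "\<And>x y. x \<bullet> f y = y \<bullet> f x"
  shows "subspace S \<Longrightarrow> \<exists>B. B \<subseteq> S \<and> pairwise orthogonal B \<and> (\<forall>b\<in>B. norm b = 1) \<and> span B = S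
           \<and> pairwise (\<lambda>x y. x \<bullet> f y = 0) B"
proof (induction "dim S" arbitrary: S rule: less_induct)
  case less
  \<comment> \<open>A maximiser \<open>v\<close> of the form on the unit sphere of \<open>S\<close> is conjugate to its orthogonal
    complement in \<open>S\<close>.\<close>
  show ?case
  proof (cases "S = {0}")
    case True
    then show ?thesis by (intro exI[of _ "{}"]) auto
  next
    case False
    obtain s where s: "s \<in> S" "s \<noteq> 0"
      using False subspace_0[OF less.prems] by auto
    have "compact (S \<inter> sphere 0 1)"
      by (intro closed_Int_compact closed_subspace less.prems compact_sphere)
    moreover have "(1 / norm s) *\<^sub>R s \<in> S \<inter> sphere 0 1"
      using s subspace_scale[OF less.prems] by simp
    hence "S \<inter> sphere 0 1 \<noteq> {}" by blast
    moreover have "continuous_on (S \<inter> sphere 0 1) (\<lambda>x. x \<bullet> f x)"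
      using lin by (intro continuous_intros linear_continuous_on) (rule linear_conv_bounded_linear[THEN iffD1])
    ultimately obtain v where "v \<in> S \<inter> sphere 0 1"
        and "\<forall>y\<in>S \<inter> sphere 0 1. y \<bullet> f y \<le> v \<bullet> f v"
      using continuous_attains_sup by blast
    hence v: "v \<in> S" "norm v = 1"
      and max1: "\<And>y. y \<in> S \<Longrightarrow> norm y = 1 \<Longrightarrow> y \<bullet> f y \<le> v \<bullet> f v" by auto
    have vv: "v \<bullet> v = 1" using v(2) by (simp add: norm_eq_1)
    have max: "y \<bullet> f y \<le> (v \<bullet> f v) * (y \<bullet> y)" if y: "y \<in> S" for y
    proof (cases "y = 0")
      case True
      then show ?thesis by simp
    next
      case False
      have "((1 / norm y) *\<^sub>R y) \<bullet> f ((1 / norm y) *\<^sub>R y) \<le> v \<bullet> f v"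
        using False y subspace_scale[OF less.prems] by (intro max1) auto
      then show ?thesis
        using False by (simp add: linear_scale[OF lin] field_simps power2_norm_eq_inner[symmetric] power2_eq_square)
    qed
    have conj: "v \<bullet> f w = 0" if w: "w \<in> S" "w \<bullet> v = 0" for w
    proof -
      define \<beta> where "\<beta> = v \<bullet> f w"
      define \<gamma> where "\<gamma> = (v \<bullet> f v) * (w \<bullet> w) - w \<bullet> f w"
      \<comment> \<open>First-order variation of the maximiser along \<open>w\<close>: since
        \<open>w\<close> is orthogonal to \<open>v\<close>, the squared norm of
        \<open>v + t w\<close> has no linear term, so the linear term of the form has to be
        dominated by a quadratic one.\<close>
      have t: "2 * t * \<beta> \<le> t\<^sup>2 * \<gamma>" for t
      proof -
        have "v + t *\<^sub>R w \<in> S"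
          using v w less.prems by (intro subspace_add subspace_scale)
        from max[OF this] show ?thesis
          using w(2) sym[of w v] inner_commute[of w v]
          by (simp add: linear_add[OF lin] linear_scale[OF lin] inner_add_left inner_add_right vv
              \<beta>_def \<gamma>_def algebra_simps power2_eq_square)
      qed
      \<comment> \<open>Any positive number above \<open>\<gamma>\<close> will do: at
        \<open>t = \<beta> / c\<close> the bound becomes
        \<open>2 c \<beta>^2 <= \<gamma> \<beta>^2 <= c \<beta>^2\<close>, forcing
        \<open>\<beta> = 0\<close>. The absolute value covers negative
        \<open>\<gamma>\<close>.\<close>
      define c where "c = \<bar>\<gamma>\<bar> + 1"
      have c: "c > 0" "\<gamma> < c" by (auto simp: c_def)
      have "2 * (\<beta> / c) * \<beta> \<le> (\<beta> / c)\<^sup>2 * \<gamma>" by (rule t)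
      hence "2 * c * \<beta>\<^sup>2 \<le> \<gamma> * \<beta>\<^sup>2" using c(1) by (simp add: field_simps power2_eq_square)
      moreover have "\<gamma> * \<beta>\<^sup>2 \<le> c * \<beta>\<^sup>2" using c by (intro mult_right_mono) auto
      ultimately have "c * \<beta>\<^sup>2 \<le> 0" by simp
      hence "\<beta> = 0" using c(1) by (simp add: mult_le_0_iff)
      thus ?thesis by (simp add: \<beta>_def)
    qed
    define T where "T = {x \<in> S. x \<bullet> v = 0}"
    have T: "subspace T"
      using less.prems by (auto simp: T_def subspace_def inner_add_left)
    have "v \<notin> T" "T \<subseteq> S" using vv by (auto simp: T_def)
    hence "span T \<subset> span S"
      using v(1) T less.prems by (metis psubsetI span_eq_iff)
    then obtain B where B: "B \<subseteq> T" "pairwise orthogonal B" "\<forall>b\<in>B. norm b = 1" "span B = T"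
        "pairwise (\<lambda>x y. x \<bullet> f y = 0) B"
      using less.hyps[OF dim_psubset T] by auto
    have "span (insert v B) = S"
    proof
      show "span (insert v B) \<subseteq> S"
        using B(1) v(1) less.prems by (intro span_minimal) (auto simp: T_def)
      show "S \<subseteq> span (insert v B)"
      proof
        fix x assume x: "x \<in> S"
        have "x - (x \<bullet> v) *\<^sub>R v \<in> T"
          using x v vv less.prems
          by (auto simp: T_def inner_diff_left intro!: subspace_diff subspace_scale)
        thus "x \<in> span (insert v B)"
          unfolding B(4)[symmetric] by (auto simp: span_breakdown_eq)
      qed
    qed
    moreover have "pairwise orthogonal (insert v B)"
      using B(1,2) by (auto simp: pairwise_insert orthogonal_def T_def inner_commute)
    moreover have "pairwise (\<lambda>x y. x \<bullet> f y = 0) (insert v B)"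
      using B(1,5) conj sym by (auto simp: pairwise_insert T_def)
    moreover have "insert v B \<subseteq> S" "\<forall>b\<in>insert v B. norm b = 1"
      using B(1,3) v by (auto simp: T_def)
    ultimately show ?thesis by blast
  qed
qed

lemma diagonal_form_expand:
  fixes f :: "'a::euclidean_space \<Rightarrow> 'a"
  assumes lin: "linear f" and B: "pairwise orthogonal B" "\<And>b. b \<in> B \<Longrightarrow> norm b = 1" "span B = UNIV" "finite B"
    and diag: "pairwise (\<lambda>x y. x \<bullet> f y = 0) B"
  shows "x \<bullet> f x = (\<Sum>b\<in>B. (b \<bullet> f b) * (x \<bullet> b)\<^sup>2)"
proof -
  have ex: "(\<Sum>b\<in>B. (b \<bullet> y) *\<^sub>R b) = y" for y
    using orthonormal_basis_expand[OF B(1,2) _ B(4), of y] B(3) by (simp add: inner_commute)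
  \<comment> \<open>Since \<open>B\<close> spans the whole space here, conjugacy does make each
    \<open>b\<close> an eigenvector of \<open>f\<close>, with eigenvalue
    \<open>b \<bullet> f b\<close>.\<close>
  have *: "x \<bullet> f b = (x \<bullet> b) * (b \<bullet> f b)" if b: "b \<in> B" for b
  proof -
    have "x \<bullet> f b = (\<Sum>c\<in>B. (c \<bullet> x) *\<^sub>R c) \<bullet> f b" by (simp add: ex)
    also have "\<dots> = (\<Sum>c\<in>B. (c \<bullet> x) * (c \<bullet> f b))" by (simp add: inner_sum_left)
    also have "\<dots> = (\<Sum>c\<in>B. if c = b then (b \<bullet> x) * (b \<bullet> f b) else 0)"
      using diag b by (intro sum.cong) (auto simp: pairwise_def)
    finally show ?thesis using b B(4) by (simp add: inner_commute)
  qed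
  have "x \<bullet> f x = x \<bullet> f (\<Sum>b\<in>B. (b \<bullet> x) *\<^sub>R b)" by (simp add: ex)
  also have "\<dots> = (\<Sum>b\<in>B. (b \<bullet> x) * (x \<bullet> f b))"
    by (simp add: linear_sum[OF lin] linear_scale[OF lin] inner_sum_right)
  also have "\<dots> = (\<Sum>b\<in>B. (b \<bullet> f b) * (x \<bullet> b)\<^sup>2)"
    by (intro sum.cong) (auto simp: * power2_eq_square inner_commute)
  finally show ?thesis .
qed

section \<open>Rank-one matrices and the Parseval identity\<close>

text \<open>Under the entrywise inner product of matrices, pairing with \<open>outer x\<close>
  evaluates a quadratic form at \<open>x\<close> and pairing with \<open>mat 1\<close> takes the
  trace. Conditions on quadratic forms thus become linear, which opens the way to convex
  separation.\<close>

definition outer :: "real ^ 'n \<Rightarrow> real ^ 'n ^ 'n" where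
  "outer x = (\<chi> i j. x $ i * x $ j)"

lemma inner_outer: "A \<bullet> outer x = x \<bullet> (A *v x)"
  by (simp add: outer_def inner_vec_def matrix_vector_mult_def sum_distrib_left mult_ac)

lemma outer_scaleR: "outer (c *\<^sub>R x) = c\<^sup>2 *\<^sub>R outer x"
  by (simp add: outer_def vec_eq_iff power2_eq_square)

lemma inner_outer_outer: "outer y \<bullet> outer x = (x \<bullet> y)\<^sup>2"
  by (simp add: outer_def inner_vec_def power2_eq_square sum_product mult_ac)

text \<open>Translates the Parseval identity into a single matrix equation. One direction pairs both
  sides with \<open>outer x\<close>; the other polarises the identity and reads off the matrix
  entries at coordinate vectors.\<close>

lemma sum_outer_eq_mat_iff:
  fixes v :: "'i \<Rightarrow> real ^ 'n"
  shows "(\<Sum>i\<in>I. outer (v i)) = mat 1 \<longleftrightarrow> (\<forall>x. (\<Sum>i\<in>I. (x \<bullet> v i)\<^sup>2) = (norm x)\<^sup>2)"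
proof
  assume eq: "(\<Sum>i\<in>I. outer (v i)) = mat 1"
  show "\<forall>x. (\<Sum>i\<in>I. (x \<bullet> v i)\<^sup>2) = (norm x)\<^sup>2"
  proof
    fix x
    have "(\<Sum>i\<in>I. (x \<bullet> v i)\<^sup>2) = (\<Sum>i\<in>I. outer (v i)) \<bullet> outer x"
      by (simp add: inner_sum_left inner_outer_outer)
    thus "(\<Sum>i\<in>I. (x \<bullet> v i)\<^sup>2) = (norm x)\<^sup>2"
      by (simp add: eq inner_outer power2_norm_eq_inner)
  qed
next
  assume P: "\<forall>x. (\<Sum>i\<in>I. (x \<bullet> v i)\<^sup>2) = (norm x)\<^sup>2"
  have polar: "(\<Sum>i\<in>I. (x \<bullet> v i) * (y \<bullet> v i)) = x \<bullet> y" for x y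
  proof -
    have "(\<Sum>i\<in>I. ((x + y) \<bullet> v i)\<^sup>2) = (norm (x + y))\<^sup>2"
      using P by blast
    hence "(\<Sum>i\<in>I. (x \<bullet> v i)\<^sup>2) + (\<Sum>i\<in>I. (y \<bullet> v i)\<^sup>2) + 2 * (\<Sum>i\<in>I. (x \<bullet> v i) * (y \<bullet> v i))
        = (norm x)\<^sup>2 + (norm y)\<^sup>2 + 2 * (x \<bullet> y)"
      by (simp add: power2_norm_eq_inner inner_add_left inner_add_right power2_sum sum.distrib
          sum_distrib_left mult.assoc inner_commute)
    thus ?thesis using P by simp
  qed
  show "(\<Sum>i\<in>I. outer (v i)) = mat 1"
    unfolding vec_eq_iff
  proof (intro allI)
    fix k l
    show "(\<Sum>i\<in>I. outer (v i)) $ k $ l = (mat 1 :: real^'n^'n) $ k $ l"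
      using polar[of "axis k 1" "axis l 1"]
      by (simp add: outer_def mat_def inner_axis') (simp add: axis_def)
  qed
qed

lemma parseval_frame_iff:
  "parseval_frame M \<phi> \<longleftrightarrow> (\<forall>x. (\<Sum>j=1..M. (x \<bullet> \<phi> j)\<^sup>2) = (norm x)\<^sup>2)"
  by (auto simp: parseval_frame_def frame_bounds_def intro: antisym)

lemma orthonormal_parseval:
  fixes B :: "'a::euclidean_space set"
  assumes B: "pairwise orthogonal B" "\<And>b. b \<in> B \<Longrightarrow> norm b = 1" "span B = UNIV" "finite B"
  shows "(\<Sum>b\<in>B. (x \<bullet> b)\<^sup>2) = (norm x)\<^sup>2"
proof -
  have ex: "(\<Sum>b\<in>B. (b \<bullet> y) *\<^sub>R b) = y" for y
    using orthonormal_basis_expand[OF B(1,2) _ B(4), of y] B(3) by (simp add: inner_commute)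
  have "(norm x)\<^sup>2 = x \<bullet> (\<Sum>b\<in>B. (b \<bullet> x) *\<^sub>R b)" by (simp add: ex power2_norm_eq_inner)
  thus ?thesis by (simp add: inner_sum_right power2_eq_square inner_commute)
qed

section \<open>Separation of the identity from the rank-one matrices\<close>

lemma not_scalable_imp_separating_matrix:
  fixes \<phi> :: "nat \<Rightarrow> real ^ 'n"
  assumes ns: "\<not> scalable M \<phi>" and nz: "\<forall>j\<in>{1..M}. \<phi> j \<noteq> 0"
  shows "\<exists>A :: real ^ 'n ^ 'n. A \<bullet> mat 1 = 0 \<and> (\<forall>j\<in>{1..M}. A \<bullet> outer (\<phi> j) > 0)"
proof -
  define N where "N = real CARD('n)"
  have N: "N > 0" by (simp add: N_def)
  define g where "g j = (1 / (norm (\<phi> j))\<^sup>2) *\<^sub>R outer (\<phi> j)" for j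
  \<comment> \<open>Weights are indexed by \<open>j\<close>, not by the matrices: parallel frame
    vectors share the same \<open>g j\<close> but each needs its own scalar. Only the inclusion of
    the convex hull in \<open>T\<close> is needed.\<close>
  define T where "T = {y. \<exists>u. (\<forall>j\<in>{1..M}. u j \<ge> 0) \<and> sum u {1..M} = 1 \<and> y = (\<Sum>j=1..M. u j *\<^sub>R g j)}"
  have "convex T"
  proof (rule convexI)
    fix x y and s t :: real
    assume "x \<in> T" "y \<in> T" and st: "0 \<le> s" "0 \<le> t" "s + t = 1"
    then obtain u w where u: "\<forall>j\<in>{1..M}. u j \<ge> 0" "sum u {1..M} = 1" "x = (\<Sum>j=1..M. u j *\<^sub>R g j)"
      and w: "\<forall>j\<in>{1..M}. w j \<ge> 0" "sum w {1..M} = 1" "y = (\<Sum>j=1..M. w j *\<^sub>R g j)"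
      unfolding T_def by blast
    show "s *\<^sub>R x + t *\<^sub>R y \<in> T"
      unfolding T_def mem_Collect_eq
    proof (intro exI[of _ "\<lambda>j. s * u j + t * w j"] conjI)
      show "\<forall>j\<in>{1..M}. 0 \<le> s * u j + t * w j" using u w st by simp
      show "(\<Sum>j=1..M. s * u j + t * w j) = 1"
        using u(2) w(2) st by (simp add: sum.distrib sum_distrib_left[symmetric])
      show "s *\<^sub>R x + t *\<^sub>R y = (\<Sum>j=1..M. (s * u j + t * w j) *\<^sub>R g j)"
        by (simp add: u(3) w(3) scaleR_add_left sum.distrib scaleR_sum_right)
    qed
  qed
  moreover have "g ` {1..M} \<subseteq> T"
  proof safe
    fix j assume j: "j \<in> {1..M}"
    show "g j \<in> T"
      unfolding T_def mem_Collect_eq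
    proof (intro exI[of _ "\<lambda>i. if i = j then 1 else 0"] conjI)
      have "(\<Sum>i=1..M. (if i = j then 1 else 0) *\<^sub>R g i) = (\<Sum>i=1..M. if i = j then g i else 0)"
        by (intro sum.cong) auto
      thus "g j = (\<Sum>i=1..M. (if i = j then 1 else 0) *\<^sub>R g i)" using j by simp
    qed (use j in auto)
  qed
  ultimately have hull: "convex hull (g ` {1..M}) \<subseteq> T" by (rule hull_minimal[rotated])
  have "(1 / N) *\<^sub>R mat 1 \<notin> T"
  proof
    assume "(1 / N) *\<^sub>R mat 1 \<in> T"
    then obtain u where u: "\<forall>j\<in>{1..M}. u j \<ge> 0" "(1 / N) *\<^sub>R mat 1 = (\<Sum>j=1..M. u j *\<^sub>R g j)"
      unfolding T_def by blast
    \<comment> \<open>Solves \<open>(c j)^2 * (norm (\<phi> j))^2 = N * u j\<close>, so that convex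
      weights representing \<open>I / N\<close> become scaling factors representing
      \<open>I\<close>.\<close>
    define c where "c j = sqrt (N * u j) / norm (\<phi> j)" for j
    have "(\<Sum>j=1..M. outer (c j *\<^sub>R \<phi> j)) = (\<Sum>j=1..M. N *\<^sub>R (u j *\<^sub>R g j))"
      using u(1) N by (intro sum.cong) (auto simp: outer_scaleR c_def g_def power_divide)
    also have "\<dots> = N *\<^sub>R ((1 / N) *\<^sub>R mat 1)" unfolding u(2) by (simp add: scaleR_sum_right)
    also have "\<dots> = mat 1" using N by simp
    finally have "parseval_frame M (\<lambda>j. c j *\<^sub>R \<phi> j)"
      unfolding sum_outer_eq_mat_iff parseval_frame_iff .
    moreover have "\<forall>j\<in>{1..M}. c j \<ge> 0" using u(1) N by (auto simp: c_def)
    ultimately show False using ns unfolding scalable_def by blast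
  qed
  hence "(1 / N) *\<^sub>R mat 1 \<notin> convex hull (g ` {1..M})" using hull by blast
  moreover have "closed (convex hull (g ` {1..M}))"
    by (intro compact_imp_closed finite_imp_compact_convex_hull) auto
  ultimately obtain A b where A: "A \<bullet> ((1 / N) *\<^sub>R mat 1) < b" "\<forall>y\<in>convex hull (g ` {1..M}). A \<bullet> y > b"
    using separating_hyperplane_closed_point[OF convex_convex_hull] by blast
  \<comment> \<open>This is the value of \<open>A\<close> at \<open>I / N\<close>, and also the
    multiple of the identity that removes the trace, as \<open>mat 1\<close> paired with itself
    gives \<open>N\<close>. Each \<open>g j\<close> has trace 1, so the subtraction turns
    \<open>A \<bullet> g j > t\<close> into strict positivity.\<close>
  define t where "t = (A \<bullet> mat 1) / N"
  have "mat 1 \<bullet> (mat 1 :: real^'n^'n) = N"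
    by (simp add: inner_vec_def mat_def if_distrib[of "\<lambda>x. x * _"] N_def cong: if_cong)
  hence "(A - t *\<^sub>R mat 1) \<bullet> mat 1 = 0"
    using N by (simp add: inner_diff_left t_def)
  moreover have "(A - t *\<^sub>R mat 1) \<bullet> outer (\<phi> j) > 0" if j: "j \<in> {1..M}" for j
  proof -
    have "t < A \<bullet> g j"
      using A(1) A(2)[rule_format, OF hull_inc, of "g j"] j by (simp add: t_def)
    moreover have "(norm (\<phi> j))\<^sup>2 > 0" using nz j by simp
    ultimately have "t * (norm (\<phi> j))\<^sup>2 < A \<bullet> outer (\<phi> j)"
      by (simp add: g_def field_simps)
    moreover have "mat 1 \<bullet> outer (\<phi> j) = (norm (\<phi> j))\<^sup>2"
      by (simp add: inner_outer power2_norm_eq_inner)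
    ultimately show ?thesis by (simp add: inner_diff_left)
  qed
  ultimately show ?thesis by blast
qed

section \<open>From a traceless quadratic form to quadrics\<close>

lemma traceless_matrix_diagonalize:
  fixes A :: "real ^ 'n ^ 'n"
  assumes A: "A \<bullet> mat 1 = 0"
  shows "\<exists>B l. pairwise orthogonal B \<and> (\<forall>b\<in>B. norm b = 1) \<and> span B = UNIV \<and> finite B
      \<and> (\<Sum>b\<in>B. l b) = 0 \<and> (\<forall>x. A \<bullet> outer x = (\<Sum>b\<in>B. l b * (x \<bullet> b)\<^sup>2))"
proof -
  \<comment> \<open>The separating matrix need not be symmetric; its symmetric part has the same
    quadratic form.\<close>
  define f where "f x = (1/2) *\<^sub>R (A *v x + transpose A *v x)" for x
  have lin: "linear f"
    unfolding f_def by (intro linear_compose_scale_right linear_compose_add matrix_vector_mul_linear)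
  have f: "x \<bullet> f y = (x \<bullet> (A *v y) + y \<bullet> (A *v x)) / 2" for x y
    using dot_lmul_matrix[of y A x] 
    by (simp add: f_def inner_add_right inner_commute)
  have sym: "x \<bullet> f y = y \<bullet> f x" for x y by (simp add: f)
  have fx: "A \<bullet> outer x = x \<bullet> f x" for x by (simp add: f inner_outer)
  obtain B where B: "pairwise orthogonal B" "\<forall>b\<in>B. norm b = 1" "span B = UNIV"
      "pairwise (\<lambda>x y. x \<bullet> f y = 0) B"
    using orthonormal_diagonalizing_basis[OF lin sym subspace_UNIV] by auto
  have fin: "finite B" using pairwise_orthogonal_imp_finite[OF B(1)] .
  \<comment> \<open>Parseval for \<open>B\<close> says that the matrices \<open>outer b\<close> add
    up to the identity, so the diagonal values add up to the trace of \<open>A\<close>.\<close>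
  have "(\<Sum>b\<in>B. b \<bullet> f b) = A \<bullet> (\<Sum>b\<in>B. outer b)" by (simp add: fx inner_sum_right)
  also have "(\<Sum>b\<in>B. outer b) = mat 1"
    unfolding sum_outer_eq_mat_iff using orthonormal_parseval[OF B(1) _ B(3) fin] B(2) by blast
  finally have "(\<Sum>b\<in>B. b \<bullet> f b) = 0" using A by simp
  moreover have "\<forall>x. A \<bullet> outer x = (\<Sum>b\<in>B. (b \<bullet> f b) * (x \<bullet> b)\<^sup>2)"
    unfolding fx using diagonal_form_expand[OF lin B(1) _ B(3) fin B(4)] B(2) by blast
  ultimately show ?thesis using B fin by (intro exI[of _ B] exI[of _ "\<lambda>b. b \<bullet> f b"]) blast
qed

text \<open>Weights are moved slightly along a direction of sum 0. Zero weights become nonzero at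
  once, while nonzero weights and the finitely many strict inequalities survive small moves.\<close>

lemma perturb_weights_nonzero:
  fixes l :: "'b \<Rightarrow> real" and h :: "'j \<Rightarrow> 'b \<Rightarrow> real"
  assumes fin: "finite B" "finite J" and ne: "J \<noteq> {}" and sum0: "sum l B = 0"
    and pos: "\<forall>j\<in>J. (\<Sum>b\<in>B. l b * h j b) > 0"
  shows "\<exists>m. sum m B = 0 \<and> (\<forall>b\<in>B. m b \<noteq> 0) \<and> (\<forall>j\<in>J. (\<Sum>b\<in>B. m b * h j b) > 0)"
proof -
  obtain j where "j \<in> J" using ne by blast
  hence "(\<Sum>b\<in>B. l b * h j b) \<noteq> 0" using pos by fastforce
  then obtain p where p: "p \<in> B" "l p \<noteq> 0" by (auto elim: sum.not_neutral_contains_not_neutral)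
  \<comment> \<open>The single compensating entry sits at \<open>p\<close>, where \<open>l\<close>
    is nonzero; hence \<open>d\<close> equals 1 wherever \<open>l\<close> vanishes.\<close>
  define d where "d b = (if b = p then - real (card (B - {p})) else 1)" for b
  have d_sum: "sum d B = 0"
  proof -
    have "sum d B = d p + sum d (B - {p})" using fin(1) p(1) by (rule sum.remove)
    also have "sum d (B - {p}) = (\<Sum>b\<in>B - {p}. 1)" by (intro sum.cong) (auto simp: d_def)
    finally show ?thesis by (simp add: d_def)
  qed
  define m where "m t b = l b + t * d b" for t b
  \<comment> \<open>The filter \<open>at_right 0\<close> leaves out \<open>t = 0\<close>, where the
    zero weights have not yet moved.\<close>
  have "eventually (\<lambda>t. m t b \<noteq> 0) (at_right 0)" if b: "b \<in> B" for b
  proof (cases "l b = 0")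
    case True
    then have "b \<noteq> p" using p by auto
    with True show ?thesis
      unfolding m_def d_def by (auto simp: eventually_at_filter)
  next
    case False
    have "((\<lambda>t. m t b) \<longlongrightarrow> m 0 b) (at_right 0)"
      unfolding m_def by (intro tendsto_intros)
    thus ?thesis using False by (intro tendsto_imp_eventually_ne) (auto simp: m_def)
  qed
  hence "eventually (\<lambda>t. \<forall>b\<in>B. m t b \<noteq> 0) (at_right 0)"
    using fin(1) by (simp add: eventually_ball_finite)
  moreover have "eventually (\<lambda>t. (\<Sum>b\<in>B. m t b * h j b) > 0) (at_right 0)" if j: "j \<in> J" for j
  proof -
    have "((\<lambda>t. \<Sum>b\<in>B. m t b * h j b) \<longlongrightarrow> (\<Sum>b\<in>B. m 0 b * h j b)) (at_right 0)"
      unfolding m_def by (intro tendsto_intros)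
    thus ?thesis using pos j by (intro order_tendstoD) (auto simp: m_def)
  qed
  hence "eventually (\<lambda>t. \<forall>j\<in>J. (\<Sum>b\<in>B. m t b * h j b) > 0) (at_right 0)"
    using fin(2) by (simp add: eventually_ball_finite)
  ultimately have "eventually (\<lambda>t. (\<forall>b\<in>B. m t b \<noteq> 0) \<and> (\<forall>j\<in>J. (\<Sum>b\<in>B. m t b * h j b) > 0)) (at_right 0)"
    by (rule eventually_conj)
  then obtain t where "(\<forall>b\<in>B. m t b \<noteq> 0) \<and> (\<forall>j\<in>J. (\<Sum>b\<in>B. m t b * h j b) > 0)"
    using eventually_happens' trivial_limit_at_right_real by blast
  moreover have "sum (m t) B = 0"
    using sum0 d_sum by (simp add: m_def sum.distrib sum_distrib_left[symmetric])
  ultimately show ?thesis by blast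
qed

text \<open>Dividing by \<open>- l p\<close> turns the vanishing of the weight sum into coefficients
  \<open>a k\<close> of sum 1. The sign of \<open>l p\<close> is left open: it decides whether
  positivity of the form means interior or exterior.\<close>

lemma weighted_basis_quadric_data:
  fixes B :: "(real ^ 'n) set"
  assumes B: "pairwise orthogonal B" "\<forall>b\<in>B. norm b = 1" "span B = UNIV" "finite B"
    and l: "sum l B = 0" "\<forall>b\<in>B. l b \<noteq> 0" and p: "p \<in> B"
  shows "\<exists>e a. quadric_data e a \<and>
     (\<forall>x. (x \<bullet> e CARD('n))\<^sup>2 - (\<Sum>k=1..CARD('n) - 1. a k * (x \<bullet> e k)\<^sup>2)
          = (\<Sum>b\<in>B. l b * (x \<bullet> b)\<^sup>2) / l p)"
proof -
  have "0 \<notin> B" using B(2) by force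
  hence "independent B" using pairwise_orthogonal_independent[OF B(1)] by blast
  hence "card B = dim (UNIV :: (real ^ 'n) set)" using dim_eq_card[of B UNIV] B(3) by simp
  hence "card B = CARD('n)" by simp
  hence "card (B - {p}) = CARD('n) - 1" using p B(4) by simp
  then obtain h where h: "bij_betw h {1..CARD('n) - 1} (B - {p})"
    using ex_bij_betw_nat_finite_1[of "B - {p}"] B(4) by auto
  \<comment> \<open>The enumeration \<open>h\<close> covers indices up to
    \<open>CARD('n) - 1\<close> only, so the last index is free for \<open>p\<close>.\<close>
  define e where "e = h(CARD('n) := p)"
  define a where "a k = - l (e k) / l p" for k
  have I: "{1..CARD('n)} = insert CARD('n) {1..CARD('n) - 1}"
    and nI: "CARD('n) \<notin> {1..CARD('n) - 1}"
    using zero_less_card_finite[where 'a='n] by (auto simp del: zero_less_card_finite)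
  have eN: "e CARD('n) = p" by (simp add: e_def)
  have bij': "bij_betw e {1..CARD('n) - 1} (B - {p})"
    using h nI by (subst bij_betw_cong[of _ _ h]) (auto simp: e_def)
  hence bij: "bij_betw e {1..CARD('n)} B"
    using notIn_Un_bij_betw[OF nI, of e "B - {p}"] p unfolding I eN by (simp add: insert_absorb)
  have "orthonormal_basis e"
    unfolding orthonormal_basis_def
  proof (intro conjI ballI)
    show "span (e ` {1..CARD('n)}) = UNIV" using bij B(3) by (simp add: bij_betw_def)
    fix i k assume ik: "i \<in> {1..CARD('n)}" "k \<in> {1..CARD('n)}"
    hence "e i \<in> B" "e k \<in> B" "e i = e k \<longleftrightarrow> i = k"
      using bij_betwE[OF bij] inj_on_eq_iff[OF bij_betw_imp_inj_on[OF bij]] by blast+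
    thus "e i \<bullet> e k = (if i = k then 1 else 0)"
      using B(1,2) by (auto simp: pairwise_def orthogonal_def norm_eq_1)
  qed
  have lp: "l p \<noteq> 0" using l(2) p by blast
  \<comment> \<open>A general \<open>F\<close> serves twice: the constant 1 yields the sum of the
    \<open>a k\<close>, and the squared coordinate yields the form.\<close>
  have sum_e: "(\<Sum>k=1..CARD('n) - 1. a k * F (e k)) = - (\<Sum>b\<in>B - {p}. l b * F b) / l p" for F :: "real ^ 'n \<Rightarrow> real"
  proof -
    have "(\<Sum>k=1..CARD('n) - 1. a k * F (e k)) = (\<Sum>k=1..CARD('n) - 1. (\<lambda>b. - (l b * F b) / l p) (e k))"
      by (intro sum.cong) (auto simp: a_def)
    also have "\<dots> = (\<Sum>b\<in>B - {p}. - (l b * F b) / l p)"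
      by (rule sum.reindex_bij_betw[OF bij'])
    also have "\<dots> = - (\<Sum>b\<in>B - {p}. l b * F b) / l p"
      by (simp add: sum_negf sum_divide_distrib)
    finally show ?thesis .
  qed
  have rem: "(\<Sum>b\<in>B. l b * F b) = l p * F p + (\<Sum>b\<in>B - {p}. l b * F b)" for F :: "real ^ 'n \<Rightarrow> real"
    using B(4) p by (rule sum.remove)
  have "(\<Sum>k=1..CARD('n) - 1. a k) = 1"
  proof -
    have "sum l (B - {p}) = - l p" using rem[of "\<lambda>_. 1"] l(1) by simp
    thus ?thesis using sum_e[of "\<lambda>_. 1"] lp by simp
  qed
  moreover have "\<forall>k\<in>{1..CARD('n) - 1}. a k \<noteq> 0"
    using bij' l(2) lp by (auto simp: a_def bij_betw_def)
  ultimately have "quadric_data e a" using \<open>orthonormal_basis e\<close> by (simp add: quadric_data_def)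
  moreover have "(x \<bullet> e CARD('n))\<^sup>2 - (\<Sum>k=1..CARD('n) - 1. a k * (x \<bullet> e k)\<^sup>2)
          = (\<Sum>b\<in>B. l b * (x \<bullet> b)\<^sup>2) / l p" for x
    using sum_e[of "\<lambda>b. (x \<bullet> b)\<^sup>2"] rem[of "\<lambda>b. (x \<bullet> b)\<^sup>2"] lp by (simp add: eN field_simps)
  ultimately show ?thesis by blast
qed

text \<open>One form serves both conclusions: nonzero weights of sum 0 on a nonempty basis take both
  signs, and either sign can be normalised to \<open>e N\<close>.\<close>

lemma not_scalable_imp_one_sided_quadrics:
  fixes \<phi> :: "nat \<Rightarrow> real ^ 'n"
  assumes ns: "\<not> scalable M \<phi>" and nz: "\<forall>j\<in>{1..M}. \<phi> j \<noteq> 0" and M: "M \<ge> 1"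
  shows "\<exists>e a. quadric_data e a \<and> (\<forall>j\<in>{1..M}. \<phi> j \<in> quadric_interior e a)"
    and "\<exists>e a. quadric_data e a \<and> (\<forall>j\<in>{1..M}. \<phi> j \<in> quadric_exterior e a)"
proof -
  obtain A :: "real ^ 'n ^ 'n" where A: "A \<bullet> mat 1 = 0" "\<forall>j\<in>{1..M}. A \<bullet> outer (\<phi> j) > 0"
    using not_scalable_imp_separating_matrix[OF ns nz] by blast
  obtain B l0 where B: "pairwise orthogonal B" "\<forall>b\<in>B. norm b = 1" "span B = UNIV" "finite B"
      and l0: "sum l0 B = 0" "\<forall>x. A \<bullet> outer x = (\<Sum>b\<in>B. l0 b * (x \<bullet> b)\<^sup>2)"
    using traceless_matrix_diagonalize[OF A(1)] by blast
  have "\<exists>l. sum l B = 0 \<and> (\<forall>b\<in>B. l b \<noteq> 0) \<and> (\<forall>j\<in>{1..M}. (\<Sum>b\<in>B. l b * (\<phi> j \<bullet> b)\<^sup>2) > 0)"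
    using A(2) l0 B(4) M by (intro perturb_weights_nonzero[of B _ l0]) auto
  then obtain l where l: "sum l B = 0" "\<forall>b\<in>B. l b \<noteq> 0"
      and pos: "\<forall>j\<in>{1..M}. (\<Sum>b\<in>B. l b * (\<phi> j \<bullet> b)\<^sup>2) > 0" by blast
  have "B \<noteq> {}" using pos M by fastforce
  have "\<exists>p\<in>B. l p > 0"
  proof (rule ccontr)
    assume "\<not> (\<exists>p\<in>B. l p > 0)"
    hence "(\<Sum>b\<in>B. - l b) > 0" using l(2) B(4) \<open>B \<noteq> {}\<close>
      by (intro sum_pos) (auto simp: not_less order.strict_iff_order)
    thus False using l(1) by (simp add: sum_negf)
  qed
  then obtain p where p: "p \<in> B" "l p > 0" by blast
  have "\<exists>q\<in>B. l q < 0"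
  proof (rule ccontr)
    assume "\<not> (\<exists>q\<in>B. l q < 0)"
    hence "sum l B > 0" using l(2) B(4) \<open>B \<noteq> {}\<close>
      by (intro sum_pos) (auto simp: not_less order.strict_iff_order)
    thus False using l(1) by simp
  qed
  then obtain q where q: "q \<in> B" "l q < 0" by blast
  obtain e a where ea: "quadric_data e a"
     "\<forall>x. (x \<bullet> e CARD('n))\<^sup>2 - (\<Sum>k=1..CARD('n) - 1. a k * (x \<bullet> e k)\<^sup>2) = (\<Sum>b\<in>B. l b * (x \<bullet> b)\<^sup>2) / l p"
    using weighted_basis_quadric_data[OF B l p(1)] by blast
  have "\<phi> j \<in> quadric_interior e a" if "j \<in> {1..M}" for j
    using ea(2)[rule_format, of "\<phi> j"] divide_pos_pos[OF pos[rule_format, OF that] p(2)]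
    by (simp add: quadric_interior_def)
  with ea(1) show "\<exists>e a. quadric_data e a \<and> (\<forall>j\<in>{1..M}. \<phi> j \<in> quadric_interior e a)" by blast
  obtain e' a' where ea': "quadric_data e' a'"
     "\<forall>x. (x \<bullet> e' CARD('n))\<^sup>2 - (\<Sum>k=1..CARD('n) - 1. a' k * (x \<bullet> e' k)\<^sup>2) = (\<Sum>b\<in>B. l b * (x \<bullet> b)\<^sup>2) / l q"
    using weighted_basis_quadric_data[OF B l q(1)] by blast
  have "\<phi> j \<in> quadric_exterior e' a'" if "j \<in> {1..M}" for j
    using ea'(2)[rule_format, of "\<phi> j"] divide_pos_neg[OF pos[rule_format, OF that] q(2)]
    by (simp add: quadric_exterior_def)
  with ea'(1) show "\<exists>e a. quadric_data e a \<and> (\<forall>j\<in>{1..M}. \<phi> j \<in> quadric_exterior e a)" by blast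
qed

section \<open>The converse and the equivalence\<close>

text \<open>The factor \<open>s\<close> treats both sides at once: 1 stands for the interior, -1 for
  the exterior.\<close>

lemma one_sided_quadric_imp_not_scalable:
  fixes \<phi> :: "nat \<Rightarrow> real ^ 'n" and s :: real
  assumes qd: "quadric_data e a"
    and side: "\<forall>j\<in>{1..M}. s * ((\<phi> j \<bullet> e CARD('n))\<^sup>2 - (\<Sum>k=1..CARD('n) - 1. a k * (\<phi> j \<bullet> e k)\<^sup>2)) > 0"
  shows "\<not> scalable M \<phi>"
proof
  assume "scalable M \<phi>"
  then obtain c where P: "\<And>x. (\<Sum>j=1..M. (x \<bullet> (c j *\<^sub>R \<phi> j))\<^sup>2) = (norm x)\<^sup>2"
    unfolding scalable_def parseval_frame_iff by blast
  define G where "G x = (x \<bullet> e CARD('n))\<^sup>2 - (\<Sum>k=1..CARD('n) - 1. a k * (x \<bullet> e k)\<^sup>2)" for x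
  have e1: "norm (e k) = 1" if "k \<in> {1..CARD('n)}" for k
    using qd that by (simp add: quadric_data_def orthonormal_basis_def norm_eq_1)
  have E: "(\<Sum>j=1..M. (c j)\<^sup>2 * (\<phi> j \<bullet> e k)\<^sup>2) = 1" if "k \<in> {1..CARD('n)}" for k
    using P[of "e k"] e1[OF that] by (simp add: power_mult_distrib inner_commute)
  have N: "CARD('n) \<in> {1..CARD('n)}" by (simp add: Suc_le_eq)
  have "(\<Sum>j=1..M. (c j)\<^sup>2 * G (\<phi> j))
      = (\<Sum>j=1..M. (c j)\<^sup>2 * (\<phi> j \<bullet> e CARD('n))\<^sup>2)
        - (\<Sum>j=1..M. \<Sum>k=1..CARD('n) - 1. a k * ((c j)\<^sup>2 * (\<phi> j \<bullet> e k)\<^sup>2))"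
    by (simp add: G_def right_diff_distrib sum_subtractf sum_distrib_left mult_ac)
  also have "(\<Sum>j=1..M. \<Sum>k=1..CARD('n) - 1. a k * ((c j)\<^sup>2 * (\<phi> j \<bullet> e k)\<^sup>2))
      = (\<Sum>k=1..CARD('n) - 1. a k * (\<Sum>j=1..M. (c j)\<^sup>2 * (\<phi> j \<bullet> e k)\<^sup>2))"
    by (subst sum.swap) (simp add: sum_distrib_left)
  also have "\<dots> = (\<Sum>k=1..CARD('n) - 1. a k)"
  proof (rule sum.cong[OF refl])
    fix k assume "k \<in> {1..CARD('n) - 1}"
    hence "k \<in> {1..CARD('n)}" by auto
    from E[OF this] show "a k * (\<Sum>j=1..M. (c j)\<^sup>2 * (\<phi> j \<bullet> e k)\<^sup>2) = a k" by simp
  qed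
  \<comment> \<open>Each basis direction contributes total weight 1, which leaves 1 minus the sum of
    the \<open>a k\<close>.\<close>
  finally have "(\<Sum>j=1..M. (c j)\<^sup>2 * G (\<phi> j)) = 0"
    using E[OF N] qd by (simp add: quadric_data_def)
  hence "s * (\<Sum>j=1..M. (c j)\<^sup>2 * G (\<phi> j)) = 0" by simp
  hence "(\<Sum>j=1..M. (c j)\<^sup>2 * (s * G (\<phi> j))) = 0"
    by (simp add: sum_distrib_left mult_ac)
  moreover have side': "s * G (\<phi> j) > 0" if "j \<in> {1..M}" for j
    using side that by (simp add: G_def)
  hence "\<forall>j\<in>{1..M}. (c j)\<^sup>2 * (s * G (\<phi> j)) \<ge> 0"
    by (meson less_imp_le mult_nonneg_nonneg zero_le_power2)
  ultimately have "\<forall>j\<in>{1..M}. (c j)\<^sup>2 * (s * G (\<phi> j)) = 0"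
    by (subst (asm) sum_nonneg_eq_0_iff) auto
  hence "\<forall>j\<in>{1..M}. c j = 0" using side' by fastforce
  \<comment> \<open>With all scalars zero, the Parseval sum at \<open>e N\<close> would be 0 instead
    of 1.\<close>
  thus False using E[OF N] by simp
qed

theorem theorem3p6:
  fixes \<phi> :: "nat \<Rightarrow> real ^ 'n" and M :: nat
  assumes "is_frame M \<phi>"
    and "\<forall>j\<in>{1..M}. \<phi> j \<noteq> 0"
  shows "((\<not> scalable M \<phi>) \<longleftrightarrow>
            (\<exists>Q\<in>conical_zero_trace_quadrics. \<exists>e a. quadric_data e a \<and> Q = quadric e a \<and>
               (\<forall>j\<in>{1..M}. \<phi> j \<in> quadric_interior e a)))
       \<and> ((\<not> scalable M \<phi>) \<longleftrightarrow>
            (\<exists>Q\<in>conical_zero_trace_quadrics. \<exists>e a. quadric_data e a \<and> Q = quadric e a \<and>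
               (\<forall>j\<in>{1..M}. \<phi> j \<in> quadric_exterior e a)))"
proof -
  \<comment> \<open>The lower frame bound at a unit coordinate vector rules out the empty family. In
    dimension 1 that family would break the equivalence: it is not scalable, yet the class of
    quadrics is empty.\<close>
  have M: "M \<ge> 1"
  proof (rule ccontr)
    assume "\<not> M \<ge> 1"
    moreover obtain A where A: "A > 0" "\<forall>x::real^'n. A * (norm x)\<^sup>2 \<le> (\<Sum>j=1..M. \<bar>x \<bullet> \<phi> j\<bar>\<^sup>2)"
      using assms(1) unfolding is_frame_def frame_bounds_def by blast
    ultimately have "A * (norm (axis undefined 1 :: real^'n))\<^sup>2 \<le> 0"
      using A(2)[rule_format, of "axis undefined 1"] by simp
    thus False using A(1) by simp
  qed
  have int: "\<not> scalable M \<phi>" if "quadric_data e a" "\<forall>j\<in>{1..M}. \<phi> j \<in> quadric_interior e a" for e a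
    using that by (intro one_sided_quadric_imp_not_scalable[of e a M 1]) (auto simp: quadric_interior_def)
  have ext: "\<not> scalable M \<phi>" if "quadric_data e a" "\<forall>j\<in>{1..M}. \<phi> j \<in> quadric_exterior e a" for e a
    using that by (intro one_sided_quadric_imp_not_scalable[of e a M "-1"]) (auto simp: quadric_exterior_def)
  show ?thesis
    using not_scalable_imp_one_sided_quadrics[OF _ assms(2) M] int ext
    unfolding conical_zero_trace_quadrics_def by blast
qed

end
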